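(* Let $\mathbb A=(A,+)$ be a cancellative (not necessarily commutative) semigroup, let $n$ be a positive integer, and let $X_1,\ldots,X_n$ be subsets of $A$ such that $X_1^\times+\cdots+X_n^\times\neq\emptyset$. Then $$|X_1+\cdots+X_n|\ \ge\ \min(\mathfrak p(A),\ |X_1|+\cdots+|X_n|+1-n).$$
   Context: A semigroup $\mathbb A=(A,+)$ is a set $A$ with an associative binary operation $+$ (written additively, but not assumed commutative; no identity is assumed). An element $z\in A$ is cancellable if, for all $x,y\in A$, $x+z=y+z$ implies $x=y$ and $z+x=z+y$ implies $x=y$; $\mathbb A$ is cancellative if every element of $A$ is cancellable. $\mathbb A^\times$ is the set of units of $\mathbb A$: if $\mathbb A$ has an identity $0$ (i.e. is a monoid), a unit is an element having a two-sided inverse; if $\mathbb A$ has no identity, $\mathbb A^\times:=\emptyset$. For $Z\subseteq A$, $Z^\times := Z\cap \mathbb A^\times$. For sets, $X_1+\cdots+X_n:=\{x_1+\cdots+x_n : x_i\in X_i\}$. $|X|$ is the number of elements of $X$ if $X$ is finite and $|X|:=\infty$ otherwise. $\mathbb A^{(0)}$ denotes the unitization of $\mathbb A$: $\mathbb A^{(0)}:=\mathbb A$ if $\mathbb A$ has an identity, which is then denoted $0$; otherwise $\mathbb A^{(0)}$ is $A\cup\{0\}$ with a new element $0\notin A$ adjoined as identity. The order $\operatorname{ord}(z)$ of an element $z$ is the cardinality of the subsemigroup generated by $z$ (an element of $\mathbf N\cup\{\infty\}$, where $\mathbf N$ is the set of non-negative integers). For $S\subseteq A$, $\mathfrak p(S):=\inf_{z\in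 S\setminus\{0\}}\operatorname{ord}(z)$, where the order is taken in $\mathbb A^{(0)}$, with the convention $\inf\emptyset=\infty$. *)

theory Defs
  imports Complex_Main "HOL-Library.Extended_Nat"
begin

text \<open>A semigroup is a type of class \<open>semigroup_add\<close> (not assumed commutative and without identity),
  and a cancellative one a type of class \<open>cancel_semigroup_add\<close>.\<close>

definition is_identity :: "'a::semigroup_add \<Rightarrow> bool" where
  "is_identity e \<longleftrightarrow> (\<forall>x. e + x = x \<and> x + e = x)"

lemma is_identity_unique: "is_identity d \<Longrightarrow> is_identity e \<Longrightarrow> d = e"
  unfolding is_identity_def by metis

definition semigroup_units :: "'a::semigroup_add set" where
  "semigroup_units = {u. \<exists>e. is_identity e \<and> (\<exists>v. u + v = e \<and> v + u = e)}"

text \<open>Cardinalities are in \<open>enat\<close>, where subtraction truncates. This is harmless in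
  \<open>(\<Sum>i=1..n. ecard (X i)) + 1 - enat n\<close> as soon as the sets \<open>X 1, \<dots>, X n\<close> are non-empty.\<close>

definition ecard :: "'a set \<Rightarrow> enat" where
  "ecard S = (if finite S then enat (card S) else \<infinity>)"

text \<open>Since no zero is available in the type, the sum \<open>x 1 + \<dots> + x n\<close> starts from
  \<open>x 1\<close>; it is meaningful for \<open>n \<ge> 1\<close> only.\<close>

definition seq_sum :: "nat \<Rightarrow> (nat \<Rightarrow> 'a::semigroup_add) \<Rightarrow> 'a" where
  "seq_sum n x = foldl (\<lambda>s i. s + x i) (x 1) [2..<Suc n]"

lemma seq_sum_1: "seq_sum 1 x = x 1"
  by (simp add: seq_sum_def)

lemma seq_sum_Suc: "n \<ge> 1 \<Longrightarrow> seq_sum (Suc n) x = seq_sum n x + x (Suc n)"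
  by (simp add: seq_sum_def)

definition sum_set :: "nat \<Rightarrow> (nat \<Rightarrow> 'a::semigroup_add set) \<Rightarrow> 'a set" where
  "sum_set n X = {seq_sum n x | x. \<forall>i\<in>{1..n}. x i \<in> X i}"

text \<open>The unitization lives in \<open>'a option\<close>, with \<open>'a\<close> embedded by \<open>Some\<close>. If the semigroup has an
  identity, nothing is adjoined: the carrier is \<open>range Some\<close>, and \<open>None\<close> is a value outside of it.
  Otherwise \<open>None\<close> is the adjoined zero.\<close>

definition unitization :: "'a::semigroup_add option set" where
  "unitization = (if \<exists>e::'a. is_identity e then range Some else UNIV)"

fun uadd :: "'a::semigroup_add option \<Rightarrow> 'a option \<Rightarrow> 'a option" where
  "uadd (Some x) (Some y) = Some (x + y)"
| "uadd None b = b"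
| "uadd a None = a"

definition uzero :: "'a::semigroup_add option" where
  "uzero = (if \<exists>e::'a. is_identity e then Some (THE e. is_identity e) else None)"

lemma uzero_eq_Some: "is_identity e \<Longrightarrow> uzero = Some e"
  unfolding uzero_def using is_identity_unique by (auto intro!: the_equality)

lemma uadd_closed: "a \<in> unitization \<Longrightarrow> b \<in> unitization \<Longrightarrow> uadd a b \<in> unitization"
  by (auto simp: unitization_def split: if_splits)

lemma uadd_assoc: "uadd (uadd a b) c = uadd a (uadd b c)"
  by (cases a; cases b; cases c) (auto simp: add.assoc)

lemma uzero_in_unitization: "(uzero :: 'a::semigroup_add option) \<in> unitization"
  by (auto simp: uzero_def unitization_def)

lemma uadd_uzero:
  fixes a :: "'a::semigroup_add option"
  assumes "a \<in> unitization"
  shows "uadd uzero a = a" and "uadd a uzero = a"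
proof -
  have "uadd uzero a = a \<and> uadd a uzero = a"
  proof (cases "\<exists>e::'a. is_identity e")
    case True
    then obtain e :: 'a where e: "is_identity e" by blast
    from True assms obtain x where "a = Some x" by (auto simp: unitization_def)
    with e show ?thesis by (simp add: uzero_eq_Some[OF e] is_identity_def)
  next
    case False
    then show ?thesis by (cases a) (auto simp: uzero_def)
  qed
  then show "uadd uzero a = a" and "uadd a uzero = a" by blast+
qed

definition subsemigroup :: "'a::semigroup_add option set \<Rightarrow> bool" where
  "subsemigroup H \<longleftrightarrow> H \<subseteq> unitization \<and> (\<forall>a\<in>H. \<forall>b\<in>H. uadd a b \<in> H)"

text \<open>Order of an element of the unitization; \<open>subsemigroup hull {z}\<close> is the intersection of all
  subsemigroups containing \<open>z\<close>.\<close>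

definition elem_order :: "'a::semigroup_add option \<Rightarrow> enat" where
  "elem_order z = ecard (subsemigroup hull {z})"

text \<open>The infimum of the empty set in \<open>enat\<close> is \<open>\<infinity>\<close>.\<close>

definition min_order :: "'a::semigroup_add set \<Rightarrow> enat" where
  "min_order S = (INF z \<in> Some ` S - {uzero}. elem_order z)"

end

theory Submission
  imports Defs "HOL-Library.Set_Algebras"
begin

text \<open>After a translation by units, two sets \<open>A\<close> and \<open>B\<close> both contain the identity \<open>e\<close>. If they
  have nothing else in common, then \<open>A \<union> B \<subseteq> A + B\<close> suffices. Otherwise Kemperman's transform
  is applied with some \<open>g \<noteq> e\<close> in \<open>A \<inter> B\<close>: it replaces \<open>(A, B)\<close> by
  \<open>(A \<union> (A + g), {b \<in> B. g + b \<in> B})\<close> or by \<open>({a \<in> A. a + g \<in> A}, B \<union> (g + B))\<close>. Both pairs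
  still contain \<open>e\<close> and have their sumset inside \<open>A + B\<close>, and by cancellation their total
  cardinalities average to \<open>|A| + |B|\<close>. So either the total cardinality can be increased, or it can be
  kept while \<open>A\<close> shrinks, unless \<open>A + g \<subseteq> A\<close>; but then \<open>A\<close> contains the subsemigroup
  generated by \<open>g\<close>. The case of \<open>n\<close> sets is an induction.\<close>

section \<open>Cardinalities and orders of elements\<close>

lemma ecard_mono: "S \<subseteq> T \<Longrightarrow> ecard S \<le> ecard T"
  by (auto simp: ecard_def card_mono dest: finite_subset)

lemma ecard_image: "inj_on f S \<Longrightarrow> ecard (f ` S) = ecard S"
  by (simp add: ecard_def card_image finite_image_iff)

text \<open>The elements \<open>h\<close> with \<open>A + h\<close> inside \<open>A\<close> form a
  subsemigroup \<open>H\<close> containing \<open>g\<close>, hence containing the one generated by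
  \<open>g\<close>; since \<open>e\<close> lies in \<open>A\<close>, each such
  \<open>h = e + h\<close> lies in \<open>A\<close>. No explicit multiples of \<open>g\<close> are
  needed.\<close>

lemma min_order_le_ecard_if_translate_subset:
  fixes A :: "'a::semigroup_add set"
  assumes e: "is_identity e" and "e \<in> A" and "g \<noteq> e" and "\<And>a. a \<in> A \<Longrightarrow> a + g \<in> A"
  shows "min_order (UNIV :: 'a set) \<le> ecard A"
proof -
  define H where "H = {h. \<forall>a\<in>A. a + h \<in> A}"
  have "subsemigroup (Some ` H)"
    unfolding subsemigroup_def
    by (auto simp: unitization_def H_def add.assoc[symmetric])
  moreover have "Some g \<in> Some ` H"
    using assms by (simp add: H_def)
  ultimately have hull: "subsemigroup hull {Some g} \<subseteq> Some ` H"
    by (intro hull_minimal) auto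
  have "h \<in> A" if "h \<in> H" for h
  proof -
    have "e + h \<in> A" using that \<open>e \<in> A\<close> by (simp add: H_def)
    then show ?thesis using e by (simp add: is_identity_def)
  qed
  then have "subsemigroup hull {Some g} \<subseteq> Some ` A" using hull by blast
  then have "elem_order (Some g) \<le> ecard (Some ` A)"
    unfolding elem_order_def by (rule ecard_mono)
  moreover have "min_order (UNIV :: 'a set) \<le> elem_order (Some g)"
    unfolding min_order_def using \<open>g \<noteq> e\<close> by (intro INF_lower) (auto simp: uzero_eq_Some[OF e])
  ultimately show ?thesis by (simp add: ecard_image)
qed

section \<open>Two sets containing the identity\<close>

lemma card_union_translate:
  fixes A :: "'a set"
  assumes "finite A" and "inj f"
  shows "card (A \<union> f ` A) + card {a \<in> A. f a \<in> A} = 2 * card A"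
proof -
  have "f ` {a \<in> A. f a \<in> A} = A \<inter> f ` A" by auto
  then have "card {a \<in> A. f a \<in> A} = card (A \<inter> f ` A)"
    using card_image[of f "{a \<in> A. f a \<in> A}"] assms(2) by (metis inj_on_subset subset_UNIV)
  moreover have "card (f ` A) = card A"
    using assms(2) by (metis card_image inj_on_subset subset_UNIV)
  ultimately show ?thesis
    using card_Un_Int[of A "f ` A"] assms(1) by simp
qed

text \<open>The bound refers to a fixed \<open>S\<close> rather than to \<open>A + B\<close>,
  because the transform may shrink the sumset. The induction is lexicographic: either
  \<open>card A + card B\<close> grows, or it does not drop and \<open>card A\<close> falls.\<close>

lemma card_add_card_le_if_identity_mem:
  fixes A B S :: "'a::cancel_semigroup_add set"
  assumes e: "is_identity e"
    and S: "finite S" "ecard S < min_order (UNIV :: 'a set)"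
    and "e \<in> A" "e \<in> B" "A + B \<subseteq> S"
  shows "card A + card B \<le> card S + 1"
  using assms(4-6)
proof (induction "(A, B)" arbitrary: A B rule: wf_induct_rule[OF wf_measures[of
      "[\<lambda>(A, B). 2 * card S - (card A + card B), \<lambda>(A, B). card A]"]])
  case (1 A B)
  have idl: "e + x = x" and idr: "x + e = x" for x
    using e by (auto simp: is_identity_def)
  have sub: "A' \<subseteq> S \<and> B' \<subseteq> S" if "e \<in> A'" "e \<in> B'" "A' + B' \<subseteq> S" for A' B' :: "'a set"
    using that set_plus_intro[of _ A' e B'] set_plus_intro[of e A' _ B'] by (auto simp: idl idr)
  \<comment> \<open>This keeps the truncated subtraction in the first measure faithful, also for the
    transformed pairs.\<close>
  have cards: "card A' + card B' \<le> 2 * card S" if "e \<in> A'" "e \<in> B'" "A' + B' \<subseteq> S" for A' B' :: "'a set"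
    using card_mono[OF S(1)] sub[OF that] by (smt (verit) add_mono mult_2)
  have AS: "A \<subseteq> S" and BS: "B \<subseteq> S" using sub[OF 1(2-4)] by auto
  then have fin: "finite A" "finite B" using S(1) finite_subset by auto
  show ?case
  proof (cases "A \<inter> B = {e}")
    case True
    have "card (A \<union> B) \<le> card S" using S(1) AS BS by (simp add: card_mono)
    \<comment> \<open>The \<open>+ 1\<close> of the bound is the common element \<open>e\<close>,
      counted twice.\<close>
    then show ?thesis using card_Un_Int[OF fin] True by simp
  next
    case False
    then obtain g where g: "g \<in> A" "g \<in> B" "g \<noteq> e" using 1(2,3) by auto
    define A1 where "A1 = A \<union> (\<lambda>a. a + g) ` A"
    define B1 where "B1 = {b \<in> B. g + b \<in> B}"
    define A2 where "A2 = {a \<in> A. a + g \<in> A}"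
    define B2 where "B2 = B \<union> (+) g ` B"
    \<comment> \<open>Membership of \<open>e\<close> in \<open>B1\<close> amounts to
      \<open>g \<in> B\<close>, and in \<open>A2\<close> to \<open>g \<in> A\<close>; this is why
      \<open>g\<close> is taken from the intersection.\<close>
    have p1: "e \<in> A1" "e \<in> B1" using 1 g by (auto simp: A1_def B1_def idl idr)
    have p2: "e \<in> A2" "e \<in> B2" using 1 g by (auto simp: A2_def B2_def idl idr)
    have "a + g + b \<in> A + B" if "a \<in> A" "g + b \<in> B" for a b
      using set_plus_intro[OF that] by (simp add: add.assoc)
    then have "A1 + B1 \<subseteq> A + B"
      by (auto simp: A1_def B1_def elim!: set_plus_elim)
    moreover have "a + (g + b) \<in> A + B" if "a + g \<in> A" "b \<in> B" for a b
      using set_plus_intro[OF that] by (simp add: add.assoc)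
    then have "A2 + B2 \<subseteq> A + B"
      by (auto simp: A2_def B2_def elim!: set_plus_elim)
    ultimately have s1: "A1 + B1 \<subseteq> S" and s2: "A2 + B2 \<subseteq> S"
      using 1(4) by blast+
    \<comment> \<open>Both translations by \<open>g\<close> are injective. Adding the two
      identities, the totals of the new pairs sum to \<open>2 * (card A + card B)\<close>, so they
      cannot both be below \<open>card A + card B\<close>.\<close>
    have cA: "card A1 + card A2 = 2 * card A"
      unfolding A1_def A2_def using fin by (intro card_union_translate) (auto intro: injI)
    have cB: "card B2 + card B1 = 2 * card B"
      unfolding B1_def B2_def using fin by (intro card_union_translate) (auto intro: injI)
    \<comment> \<open>Here the bound on \<open>ecard S\<close> by \<open>min_order\<close> enters:
      \<open>A\<close> is too small to be stable under translation by \<open>g\<close>.\<close>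
    have "A2 \<noteq> A"
    proof
      assume "A2 = A"
      then have "a + g \<in> A" if "a \<in> A" for a using that by (auto simp: A2_def)
      then have "min_order (UNIV :: 'a set) \<le> ecard A"
        using min_order_le_ecard_if_translate_subset[OF e 1(2) g(3)] by blast
      also have "\<dots> \<le> ecard S" using AS by (rule ecard_mono)
      finally show False using S(2) by simp
    qed
    then have lt: "card A2 < card A"
      using fin by (intro psubset_card_mono) (auto simp: A2_def)
    show ?thesis
    proof (cases "card A1 + card B1 > card A + card B")
      case True
      have "2 * card S - (card A1 + card B1) < 2 * card S - (card A + card B)"
        using True cards[OF p1 s1] by linarith
      then have "card A1 + card B1 \<le> card S + 1"
        using 1(1)[OF _ p1 s1] by simp
      then show ?thesis using True by simp
    next
      case False
      then have ge: "card A2 + card B2 \<ge> card A + card B" using cA cB by linarith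
      then have "2 * card S - (card A2 + card B2) \<le> 2 * card S - (card A + card B)"
        by (rule diff_le_mono2)
      then have "card A2 + card B2 \<le> card S + 1"
        using 1(1)[OF _ p2 s2] lt by (auto simp: le_less)
      then show ?thesis using ge by simp
    qed
  qed
qed

section \<open>Two sets containing units\<close>

lemma ecard_le_ecard_plus_left:
  fixes A B :: "'a::cancel_semigroup_add set"
  assumes "b \<in> B"
  shows "ecard A \<le> ecard (A + B)"
proof -
  have "ecard ((\<lambda>a. a + b) ` A) = ecard A" by (intro ecard_image inj_onI) simp
  moreover have "(\<lambda>a. a + b) ` A \<subseteq> A + B" using assms by auto
  ultimately show ?thesis using ecard_mono by metis
qed

lemma cauchy_davenport_two_sets:
  fixes A B :: "'a::cancel_semigroup_add set"
  assumes "u \<in> A \<inter> semigroup_units" and "v \<in> B \<inter> semigroup_units"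
  shows "min_order (UNIV :: 'a set) \<le> ecard (A + B) \<or> ecard A + ecard B \<le> ecard (A + B) + 1"
proof -
  obtain e u' where e: "is_identity e" and u: "u + u' = e" "u' + u = e"
    using assms(1) by (auto simp: semigroup_units_def)
  obtain v' where v: "v + v' = e" "v' + v = e"
    using assms(2) is_identity_unique[OF e] by (auto simp: semigroup_units_def)
  \<comment> \<open>Translating \<open>A\<close> on its left and \<open>B\<close> on its right keeps
    \<open>A0 + B0\<close> a two-sided translate of \<open>A + B\<close>, even without
    commutativity.\<close>
  define A0 where "A0 = (+) u' ` A"
  define B0 where "B0 = (\<lambda>b. b + v') ` B"
  have S: "A0 + B0 = (\<lambda>c. u' + c + v') ` (A + B)"
    unfolding A0_def B0_def set_plus_image image_image
    by (force simp: add.assoc image_iff)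
  have cS: "ecard (A0 + B0) = ecard (A + B)"
    unfolding S by (intro ecard_image inj_onI) simp
  have cA: "ecard A0 = ecard A" unfolding A0_def by (intro ecard_image inj_onI) simp
  have cB: "ecard B0 = ecard B" unfolding B0_def by (intro ecard_image inj_onI) simp
  have eA: "e \<in> A0" using assms(1) u(2) unfolding A0_def by force
  have eB: "e \<in> B0" using assms(2) v(1) unfolding B0_def by force
  show ?thesis
  proof (cases "finite (A0 + B0) \<and> ecard (A0 + B0) < min_order (UNIV :: 'a set)")
    case True
    have "A0 \<subseteq> A0 + B0" "B0 \<subseteq> A0 + B0"
      using e eA eB set_plus_intro[of _ A0 e B0] set_plus_intro[of e A0 _ B0]
      by (auto simp: is_identity_def)
    then have "finite A0" "finite B0" using True finite_subset by auto
    moreover have "card A0 + card B0 \<le> card (A0 + B0) + 1"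
      using card_add_card_le_if_identity_mem[OF e] True eA eB by blast
    ultimately have "ecard A0 + ecard B0 \<le> ecard (A0 + B0) + 1"
      using True by (simp add: ecard_def one_enat_def)
    then show ?thesis by (simp add: cS cA cB)
  next
    case False
    \<comment> \<open>An infinite sumset has \<open>ecard\<close> equal to \<infinity> and so falls
      under this alternative as well.\<close>
    then have "min_order (UNIV :: 'a set) \<le> ecard (A0 + B0)"
      by (cases "finite (A0 + B0)") (simp_all add: ecard_def not_less)
    then show ?thesis by (simp add: cS)
  qed
qed

section \<open>Sums of n sets\<close>

lemma semigroup_units_add:
  fixes u v :: "'a::semigroup_add"
  assumes "u \<in> semigroup_units" and "v \<in> semigroup_units"
  shows "u + v \<in> semigroup_units"
proof -
  obtain e u' where e: "is_identity e" and u: "u + u' = e" "u' + u = e"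
    using assms(1) by (auto simp: semigroup_units_def)
  obtain v' where v: "v + v' = e" "v' + v = e"
    using assms(2) is_identity_unique[OF e] by (auto simp: semigroup_units_def)
  have id: "e + x = x" "x + e = x" for x using e by (auto simp: is_identity_def)
  have "(u + v) + (v' + u') = e" "(v' + u') + (u + v) = e"
    using u v id by (metis add.assoc)+
  then show ?thesis using e by (auto simp: semigroup_units_def)
qed

lemma seq_sum_cong:
  assumes "n \<ge> 1" and "\<And>i. i \<in> {1..n} \<Longrightarrow> x i = y i"
  shows "seq_sum n x = seq_sum n y"
  using assms by (induction n rule: dec_induct) (auto simp: seq_sum_1[unfolded One_nat_def] seq_sum_Suc)

lemma sum_set_1: "sum_set 1 X = X 1"
proof -
  have "a \<in> sum_set 1 X" if "a \<in> X 1" for a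
    unfolding sum_set_def using that by (auto simp: seq_sum_1[unfolded One_nat_def] intro!: exI[of _ "\<lambda>_. a"])
  then show ?thesis by (auto simp: sum_set_def seq_sum_1[unfolded One_nat_def])
qed

lemma sum_set_Suc:
  assumes "n \<ge> 1"
  shows "sum_set (Suc n) X = sum_set n X + X (Suc n)"
proof (intro set_eqI iffI)
  fix s assume "s \<in> sum_set (Suc n) X"
  then show "s \<in> sum_set n X + X (Suc n)"
    using assms by (auto simp: sum_set_def seq_sum_Suc intro!: set_plus_intro)
next
  fix s assume "s \<in> sum_set n X + X (Suc n)"
  then obtain x a where s: "s = seq_sum n x + a" and x: "\<forall>i\<in>{1..n}. x i \<in> X i" and a: "a \<in> X (Suc n)"
    by (auto simp: sum_set_def set_plus_def)
  have "seq_sum n x = seq_sum n (x(Suc n := a))"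
    using assms by (intro seq_sum_cong) auto
  then have "s = seq_sum (Suc n) (x(Suc n := a))" using s assms by (simp add: seq_sum_Suc)
  moreover have "\<forall>i\<in>{1..Suc n}. (x(Suc n := a)) i \<in> X i" using x a by auto
  ultimately show "s \<in> sum_set (Suc n) X" unfolding sum_set_def by blast
qed

text \<open>Provides the unit in a partial sum that the two-set bound asks for in the induction on
  \<open>n\<close>.\<close>

lemma sum_set_units_subset:
  assumes "n \<ge> 1"
  shows "sum_set n (\<lambda>i. X i \<inter> semigroup_units) \<subseteq> sum_set n X \<inter> semigroup_units"
  using assms
proof (induction n rule: dec_induct)
  case base
  then show ?case by (simp add: sum_set_1[unfolded One_nat_def])
next
  case (step n)
  have "sum_set (Suc n) (\<lambda>i. X i \<inter> semigroup_units)
      \<subseteq> (sum_set n X \<inter> semigroup_units) + (X (Suc n) \<inter> semigroup_units)"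
    unfolding sum_set_Suc[OF step(1)] using step.IH by (intro set_plus_mono2) auto
  also have "\<dots> \<subseteq> sum_set (Suc n) X \<inter> semigroup_units"
    unfolding sum_set_Suc[OF step(1)] by (auto intro: semigroup_units_add elim!: set_plus_elim)
  finally show ?case .
qed

text \<open>With \<open>n\<close> moved to the right-hand side, the induction avoids truncated
  subtraction in \<open>enat\<close>.\<close>

lemma cauchy_davenport_sum_set:
  fixes X :: "nat \<Rightarrow> 'a::cancel_semigroup_add set"
  assumes "n \<ge> 1" and "sum_set n (\<lambda>i. X i \<inter> semigroup_units) \<noteq> {}"
  shows "min_order (UNIV :: 'a set) \<le> ecard (sum_set n X) \<or>
    (\<Sum>i=1..n. ecard (X i)) + 1 \<le> ecard (sum_set n X) + enat n"
  using assms
proof (induction n rule: dec_induct)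
  case base
  then show ?case by (simp add: sum_set_1[unfolded One_nat_def] one_enat_def)
next
  case (step n)
  let ?T = "sum_set n X" and ?B = "X (Suc n)"
  let ?s = "\<Sum>i=1..n. ecard (X i)"
  from step obtain u v where u: "u \<in> sum_set n (\<lambda>i. X i \<inter> semigroup_units)"
    and v: "v \<in> ?B \<inter> semigroup_units"
    by (auto simp: sum_set_Suc set_plus_def)
  then have u': "u \<in> ?T \<inter> semigroup_units" using sum_set_units_subset step(1) by blast
  have S: "sum_set (Suc n) X = ?T + ?B" using step(1) by (rule sum_set_Suc)
  have "?s + 1 + ecard ?B \<le> ecard (?T + ?B) + enat (Suc n)"
    if "?s + 1 \<le> ecard ?T + enat n" and "ecard ?T + ecard ?B \<le> ecard (?T + ?B) + 1"
  proof -
    have "?s + 1 + ecard ?B \<le> (ecard ?T + ecard ?B) + enat n"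
      using add_right_mono[OF that(1), of "ecard ?B"] by (simp add: ac_simps)
    also have "\<dots> \<le> ecard (?T + ?B) + 1 + enat n" using that(2) by (rule add_right_mono)
    also have "\<dots> = ecard (?T + ?B) + enat (Suc n)"
      by (simp add: ac_simps one_enat_def)
    finally show ?thesis .
  qed
  \<comment> \<open>Carries the alternative \<open>min_order UNIV \<le> ecard ?T\<close> over to the
    longer sum.\<close>
  moreover have "ecard ?T \<le> ecard (?T + ?B)" using v by (intro ecard_le_ecard_plus_left) auto
  moreover have "min_order (UNIV :: 'a set) \<le> ecard ?T \<or> ?s + 1 \<le> ecard ?T + enat n"
    using step u by blast
  moreover have "min_order (UNIV :: 'a set) \<le> ecard (?T + ?B) \<or>
      ecard ?T + ecard ?B \<le> ecard (?T + ?B) + 1"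
    using u' v by (rule cauchy_davenport_two_sets)
  ultimately show ?case
    unfolding S by (auto simp: ac_simps)
qed

theorem corollary9:
  fixes X :: "nat \<Rightarrow> 'a::cancel_semigroup_add set" and n :: nat
  assumes "n \<ge> 1"
    and "sum_set n (\<lambda>i. X i \<inter> semigroup_units) \<noteq> {}"
  shows "ecard (sum_set n X) \<ge> min (min_order (UNIV :: 'a set)) ((\<Sum>i=1..n. ecard (X i)) + 1 - enat n)"
proof -
  \<comment> \<open>Valid for infinite values too: as \<open>enat n\<close> is finite,
    \<open>a = \<infinity>\<close> forces \<open>b = \<infinity>\<close>.\<close>
  have "a - enat n \<le> b" if "a \<le> b + enat n" for a b
    using that by (cases a; cases b) auto
  then show ?thesis
    using cauchy_davenport_sum_set[OF assms] by (auto simp: min_le_iff_disj)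
qed

end
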